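(* Let $J$ be a finite index set, let $g_j \colon \mathbb{R}^n \to \mathbb{R}$, $j \in J$, be differentiable (not necessarily convex) functions, and suppose that the set $C = \{ x \in \mathbb{R}^n : g_j(x) \le 0,\ j \in J \}$ is closed and convex with $0$ in its interior. Let $\varphi_C$ be the gauge function of $C$. For $\bar{x} \notin C$, define $\hat{x} = \frac{\bar{x}}{\varphi_C(\bar{x})}$, and assume that $\nabla g_j(x) \neq 0$ for all $j \in J$ and all $x \in \partial C$. Then for any $j \in J$ with $g_j(\hat{x}) = 0$, the gradient cut of $g_j$ at $\hat{x}$, $$g_j(\hat{x}) + \nabla g_j(\hat{x})^T (x - \hat{x}) \le 0,$$ is a valid supporting inequality for $C$ that separates $\bar{x}$ from $C$.
   Context: The gauge function of a convex set $C \subseteq \mathbb{R}^n$ with $0$ in its interior is $\varphi_C(x) = \inf\{ t > 0 : x \in tC \}$. $\partial C$ denotes the topological boundary of $C$. An inequality $\alpha^T x \le \beta$ is valid for $C$ if every $x \in C$ satisfies it; a valid inequality is supporting for $C$ if $\alpha^T x = \beta$ for some $x \in \partial C$; it separates $\bar{x}$ from $C$ if it is valid for $C$ and $\alpha^T \bar{x} > \beta$. *)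

theory Defs
  imports "HOL-Analysis.Analysis"
begin

text \<open>The Minkowski gauge; unrelated to the library constant \<^const>\<open>gauge\<close> of Henstock--Kurzweil
  integration.\<close>

definition gauge_function :: "(real ^ 'n) set \<Rightarrow> real ^ 'n \<Rightarrow> real" where
  "gauge_function C x = Inf {t. 0 < t \<and> x \<in> (\<lambda>y. t *\<^sub>R y) ` C}"

text \<open>The gradient is meaningful only at points of differentiability, where it exists and is unique
  (lemma \<open>gradient_gderiv\<close>).\<close>

definition gradient :: "(real ^ 'n \<Rightarrow> real) \<Rightarrow> real ^ 'n \<Rightarrow> real ^ 'n" where
  "gradient f x = (THE D. GDERIV f x :> D)"

text \<open>The pair \<open>\<alpha>\<close>, \<open>\<beta>\<close> stands for the linear inequality \<open>\<alpha> \<bullet> x \<le> \<beta>\<close>.\<close>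

definition valid_inequality :: "(real ^ 'n) set \<Rightarrow> real ^ 'n \<Rightarrow> real \<Rightarrow> bool" where
  "valid_inequality C \<alpha> \<beta> \<longleftrightarrow> (\<forall>x\<in>C. \<alpha> \<bullet> x \<le> \<beta>)"

definition supporting_inequality :: "(real ^ 'n) set \<Rightarrow> real ^ 'n \<Rightarrow> real \<Rightarrow> bool" where
  "supporting_inequality C \<alpha> \<beta> \<longleftrightarrow>
     valid_inequality C \<alpha> \<beta> \<and> (\<exists>x\<in>frontier C. \<alpha> \<bullet> x = \<beta>)"

definition separating_inequality :: "(real ^ 'n) set \<Rightarrow> real ^ 'n \<Rightarrow> real ^ 'n \<Rightarrow> real \<Rightarrow> bool" where
  "separating_inequality C y \<alpha> \<beta> \<longleftrightarrow> valid_inequality C \<alpha> \<beta> \<and> \<alpha> \<bullet> y > \<beta>"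

text \<open>The gradient cut \<open>f a + gradient f a \<bullet> (x - a) \<le> 0\<close> brought into the form \<open>\<alpha> \<bullet> x \<le> \<beta>\<close>
  with \<open>\<alpha> = gradient f a\<close>; see lemma \<open>gradient_cut_iff\<close>.\<close>

definition gradient_cut_rhs :: "(real ^ 'n \<Rightarrow> real) \<Rightarrow> real ^ 'n \<Rightarrow> real" where
  "gradient_cut_rhs f a = gradient f a \<bullet> a - f a"

lemma gradient_cut_iff:
  "gradient f a \<bullet> x \<le> gradient_cut_rhs f a \<longleftrightarrow> f a + gradient f a \<bullet> (x - a) \<le> 0"
  by (auto simp: gradient_cut_rhs_def inner_diff_right)

lemma gradient_eqI:
  assumes "GDERIV f x :> D"
  shows "gradient f x = D"
  unfolding gradient_def
proof (rule the_equality)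
  fix E assume "GDERIV f x :> E"
  then have "(\<lambda>h. h \<bullet> E) = (\<lambda>h. h \<bullet> D)"
    using assms has_derivative_unique unfolding gderiv_def by blast
  then show "E = D"
    by (metis inner_commute vector_eq_rdot)
qed (fact assms)

lemma gradient_gderiv:
  assumes "f differentiable (at x)"
  shows "GDERIV f x :> gradient f x"
proof -
  obtain f' where f': "(f has_derivative f') (at x)"
    using assms by (auto simp: differentiable_def)
  then have "linear f'"
    by (rule has_derivative_linear)
  then have "f' = (\<lambda>h. h \<bullet> adjoint f' 1)"
    using adjoint_works[of f'] by (auto simp: fun_eq_iff)
  then have "GDERIV f x :> adjoint f' 1"
    using f' unfolding gderiv_def by simp
  then show ?thesis
    by (simp add: gradient_eqI)
qed

end

theory Submission
  imports Defs
begin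

text \<open>The radial projection \<open>xhat\<close> lies in \<open>C\<close>, and \<open>g j\<close> vanishes there while being nonpositive on \<open>C\<close>;
  hence along every segment from \<open>xhat\<close> into the convex set \<open>C\<close> its directional derivative is
  nonpositive, which is validity of the cut. As \<open>C\<close> contains a small positive multiple of the
  nonzero gradient, the right-hand side of the cut is positive, and scaling \<open>xhat\<close> by the gauge of
  \<open>xbar\<close>, which exceeds 1, violates the inequality.\<close>

text \<open>The admissible scale factors form a nonempty closed set bounded below, so the infimum is
  attained. Attainment puts the scaled point into \<open>C\<close>, and minimality keeps it out of
  the interior.\<close>

lemma gauge_function_outside:
  fixes C :: "(real ^ 'n) set"
  assumes "closed C" "convex C" "0 \<in> interior C" "x \<notin> C"
  shows gauge_function_gt_1: "gauge_function C x > 1"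
    and gauge_function_scaled_in_frontier: "x /\<^sub>R gauge_function C x \<in> frontier C"
proof -
  \<comment> \<open>The bound \<open>1 \<le> t\<close> loses no factor, by \<open>gt_1\<close>
    below, and keeps \<open>t\<close> away from 0, where \<open>x /\<^sub>R t\<close> need not be
    continuous; this makes \<open>T\<close> closed.\<close>
  define T where "T = {t. 1 \<le> t \<and> x /\<^sub>R t \<in> C}"
  have gt_1: "1 < t" if "0 < t" "x /\<^sub>R t \<in> C" for t
  proof (rule ccontr)
    assume "\<not> 1 < t"
    \<comment> \<open>For \<open>t \<le> 1\<close> this convex combination of
      \<open>x /\<^sub>R t\<close> and 0 is \<open>x\<close> itself, which lies outside
      \<open>C\<close>.\<close>
    then have "t *\<^sub>R (x /\<^sub>R t) + (1 - t) *\<^sub>R 0 \<in> C"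
      using that assms interior_subset by (intro convexD) auto
    then show False
      using that assms(4) by simp
  qed
  have "{t. 0 < t \<and> x \<in> (\<lambda>y. t *\<^sub>R y) ` C} = T"
  proof -
    have "x \<in> (\<lambda>y. t *\<^sub>R y) ` C \<longleftrightarrow> x /\<^sub>R t \<in> C" if "0 < t" for t
      using that by (auto simp: image_iff intro!: bexI[of _ "x /\<^sub>R t"])
    then show ?thesis
      unfolding T_def using gt_1 by force
  qed
  then have gauge: "gauge_function C x = Inf T"
    by (simp add: gauge_function_def)
  have bdd: "bdd_below T"
    unfolding T_def by (intro bdd_belowI[of _ 1]) auto
  have "continuous_on {1..} (\<lambda>t. x /\<^sub>R t)"
    by (intro continuous_intros) auto
  then have "closed ({1..} \<inter> (\<lambda>t. x /\<^sub>R t) -` C)"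
    using assms(1) by (intro continuous_closed_preimage) auto
  moreover have "{1..} \<inter> (\<lambda>t. x /\<^sub>R t) -` C = T"
    by (auto simp: T_def)
  ultimately have closed: "closed T"
    by simp
  \<comment> \<open>Nonemptiness of \<open>T\<close>: shrinking \<open>x\<close> far enough moves it
    into the interior around 0.\<close>
  have "((\<lambda>t. x /\<^sub>R t) \<longlongrightarrow> 0) at_top"
    using tendsto_scaleR[OF tendsto_inverse_0_at_top[OF filterlim_ident] tendsto_const[of x]]
    by simp
  then have "eventually (\<lambda>t. x /\<^sub>R t \<in> interior C) at_top"
    using assms(3) by (rule topological_tendstoD[OF _ open_interior])
  then obtain t where "1 \<le> t" "x /\<^sub>R t \<in> interior C"
    using eventually_happens[OF eventually_conj[OF eventually_ge_at_top]] by force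
  then have "T \<noteq> {}"
    using interior_subset by (auto simp: T_def)
  then have mem: "gauge_function C x \<in> T"
    unfolding gauge using closed bdd by (intro closed_contains_Inf)
  then show gt: "gauge_function C x > 1"
    using gt_1 by (auto simp: T_def)
  define m where "m = gauge_function C x"
  \<comment> \<open>From an interior point one could still decrease the factor a little and stay in
    \<open>C\<close>, against the minimality of \<open>m\<close>.\<close>
  have "x /\<^sub>R m \<notin> interior C"
  proof
    assume int: "x /\<^sub>R m \<in> interior C"
    have "((\<lambda>t. x /\<^sub>R t) \<longlongrightarrow> x /\<^sub>R m) (at_left m)"
      using gt by (intro tendsto_intros) (auto simp: m_def)
    then have "eventually (\<lambda>t. x /\<^sub>R t \<in> interior C) (at_left m)"
      using int by (rule topological_tendstoD[OF _ open_interior])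
    then obtain b where b: "b < m" "\<And>t. b < t \<Longrightarrow> t < m \<Longrightarrow> x /\<^sub>R t \<in> interior C"
      unfolding eventually_at_left_field by blast
    \<comment> \<open>Staying above 1 is possible since \<open>m > 1\<close>, and membership in
      \<open>T\<close> requires it.\<close>
    obtain t where t: "max b 1 < t" "t < m"
      using dense[of "max b 1" m] b(1) gt by (auto simp: m_def)
    then have "t \<in> T"
      using b(2) interior_subset by (force simp: T_def)
    then have "m \<le> t"
      unfolding m_def gauge using bdd by (rule cInf_lower)
    then show False
      using t by simp
  qed
  then show "x /\<^sub>R gauge_function C x \<in> frontier C"
    using mem assms(1) by (auto simp: T_def m_def frontier_def)
qed

text \<open>Restricted to the segment from \<open>a\<close> to \<open>x\<close>, a positive slope at
  \<open>a\<close> would push \<open>f\<close> above \<open>f a\<close> at nearby points, which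
  convexity keeps in \<open>C\<close>. Only the one-sided increase is used, so \<open>a\<close> may
  be a boundary point.\<close>

lemma GDERIV_local_max_on_convex:
  fixes f :: "'a::real_inner \<Rightarrow> real"
  assumes "GDERIV f a :> D" "convex C" "a \<in> C" "x \<in> C"
    and "\<And>y. y \<in> C \<Longrightarrow> f y \<le> f a"
  shows "D \<bullet> (x - a) \<le> 0"
proof (rule ccontr)
  define \<phi> where "\<phi> = (\<lambda>s. f (a + s *\<^sub>R (x - a)))"
  assume "\<not> D \<bullet> (x - a) \<le> 0"
  moreover have "(\<phi> has_real_derivative D \<bullet> (x - a)) (at 0)"
  proof -
    have "(f has_derivative (\<lambda>h. h \<bullet> D)) (at (a + 0 *\<^sub>R (x - a)))"
      using assms(1) by (simp add: gderiv_def)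
    moreover have "((\<lambda>s::real. a + s *\<^sub>R (x - a)) has_derivative (\<lambda>s. s *\<^sub>R (x - a))) (at 0)"
      by (auto intro!: derivative_eq_intros)
    ultimately have "(\<phi> has_derivative (\<lambda>s. (s *\<^sub>R (x - a)) \<bullet> D)) (at 0)"
      unfolding \<phi>_def by (rule has_derivative_compose[rotated])
    moreover have "(\<lambda>s. (s *\<^sub>R (x - a)) \<bullet> D) = (*) (D \<bullet> (x - a))"
      by (simp add: fun_eq_iff inner_commute)
    ultimately show ?thesis
      by (simp only: has_field_derivative_def)
  qed
  ultimately obtain d where d: "d > 0" "\<And>s. 0 < s \<Longrightarrow> s < d \<Longrightarrow> \<phi> 0 < \<phi> (0 + s)"
    using DERIV_pos_inc_right[of \<phi>] by (metis not_le)
  \<comment> \<open>Below \<open>d\<close> the function has increased; below 1 the point is a convex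
    combination of \<open>a\<close> and \<open>x\<close>.\<close>
  obtain s where s: "0 < s" "s < min d 1"
    using dense[of 0 "min d 1"] d(1) by auto
  have "(1 - s) *\<^sub>R a + s *\<^sub>R x \<in> C"
    using assms s by (intro convexD) auto
  then have "a + s *\<^sub>R (x - a) \<in> C"
    by (simp add: algebra_simps)
  then show False
    using d(2)[of s] s assms(5) by (force simp: \<phi>_def)
qed

text \<open>Test the bound at \<open>s *\<^sub>R D\<close> for small \<open>s > 0\<close>: this
  point lies in \<open>C\<close> and has inner product \<open>s * (D \<bullet> D) > 0\<close> with
  \<open>D\<close>.\<close>

lemma interior_zero_inner_bound_pos:
  fixes D :: "'a::real_inner"
  assumes "0 \<in> interior C" "D \<noteq> 0" "\<And>x. x \<in> C \<Longrightarrow> D \<bullet> x \<le> b"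
  shows "b > 0"
proof -
  have "((\<lambda>s. s *\<^sub>R D) \<longlongrightarrow> 0 *\<^sub>R D) (at_right 0)"
    by (intro tendsto_intros)
  then have "eventually (\<lambda>s. s *\<^sub>R D \<in> interior C) (at_right 0)"
    using assms(1) by (intro topological_tendstoD[OF _ open_interior]) auto
  then obtain e where e: "e > 0" "\<And>s. 0 < s \<Longrightarrow> s < e \<Longrightarrow> s *\<^sub>R D \<in> interior C"
    unfolding eventually_at_right_field by blast
  obtain s where s: "0 < s" "s < e"
    using dense[OF e(1)] by blast
  then have "D \<bullet> (s *\<^sub>R D) \<le> b"
    using e(2) assms(3) interior_subset by blast
  moreover have "0 < D \<bullet> (s *\<^sub>R D)"
    using s assms(2) by simp
  ultimately show ?thesis
    by linarith
qed

theorem proposition10: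
  fixes J :: "'j set"
    and g :: "'j \<Rightarrow> real ^ 'n \<Rightarrow> real"
    and C :: "(real ^ 'n) set"
    and xbar xhat :: "real ^ 'n"
    and j :: 'j
  assumes finite_J: "finite J"
    and diff: "\<And>i x. i \<in> J \<Longrightarrow> g i differentiable (at x)"
    and C_eq: "C = {x. \<forall>i\<in>J. g i x \<le> 0}"
    and closed_C: "closed C"
    and convex_C: "convex C"
    and zero_interior: "0 \<in> interior C"
    and xbar: "xbar \<notin> C"
    and xhat: "xhat = xbar /\<^sub>R gauge_function C xbar"
    and gradient_nonzero: "\<And>i x. i \<in> J \<Longrightarrow> x \<in> frontier C \<Longrightarrow> gradient (g i) x \<noteq> 0"
    and j: "j \<in> J"
    and active: "g j xhat = 0"
  shows "supporting_inequality C (gradient (g j) xhat) (gradient_cut_rhs (g j) xhat) \<and>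
    separating_inequality C xbar (gradient (g j) xhat) (gradient_cut_rhs (g j) xhat)"
proof -
  let ?D = "gradient (g j) xhat" and ?m = "gauge_function C xbar"
  have m: "?m > 1" and front: "xhat \<in> frontier C"
    using gauge_function_outside[OF closed_C convex_C zero_interior xbar] xhat by auto
  have mem: "xhat \<in> C"
    using front closed_C frontier_subset_closed by blast
  have rhs: "gradient_cut_rhs (g j) xhat = ?D \<bullet> xhat"
    by (simp add: gradient_cut_rhs_def active)
  have le: "?D \<bullet> x \<le> ?D \<bullet> xhat" if "x \<in> C" for x
    using GDERIV_local_max_on_convex[OF gradient_gderiv[OF diff[OF j]] convex_C mem that] j active
    by (simp add: C_eq inner_diff_right)
  have pos: "?D \<bullet> xhat > 0"
    using zero_interior gradient_nonzero[OF j front] le by (rule interior_zero_inner_bound_pos)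
  have "xbar = ?m *\<^sub>R xhat"
    using m by (simp add: xhat)
  \<comment> \<open>Multiplying the positive number \<open>?D \<bullet> xhat\<close> by a factor
    above 1 strictly increases it, which gives separation.\<close>
  then have "?D \<bullet> xbar = ?m * (?D \<bullet> xhat)"
    by (metis inner_scaleR_right)
  then have "?D \<bullet> xbar > ?D \<bullet> xhat"
    using m pos by simp
  then show ?thesis
    using le front
    by (auto simp: supporting_inequality_def separating_inequality_def valid_inequality_def rhs)
qed

end
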